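(* For every integer $r\ge 0$, the functions $F_r(x,y)$ and $F_r(x)$ satisfy the functional equations $$(i)\quad F_r(x,y)=x^{-r(r+1)/2}\,y^{-2}\,F_r\!\left(\frac1x,\frac1y\right),$$ $$(ii)\quad F_r(x)=x^{-r(r+3)/2}\,F_r\!\left(\frac1x\right).$$
   Context: For integers $r,k,j\ge 0$ let $$\alpha_r(k,j)=\sum_{\substack{c_1+\cdots+c_r=k\\ 0\le c_1\le\cdots\le c_r}}\ \sum_{d_0=-j}^{0}\ \sum_{d_1=d_0}^{c_1}\ \sum_{d_2=d_1}^{c_2}\cdots\sum_{d_r=d_{r-1}}^{c_r}1,$$ with all $c_i,d_i$ integers (for $r=0$ the outer sum is empty unless $k=0$, in which case $\alpha_0(0,j)=j+1$). Let $\alpha_r(k)$ be the number of pairs of integer sequences $0\le c_1\le\cdots\le c_r$, $0\le d_1\le\cdots\le d_r$ with $c_1+\cdots+c_r=k$ and $d_i\le c_i$ for all $i$. The generating functions are $$F_r(x)=\sum_{k=0}^\infty\alpha_r(k)x^k,\qquad F_r(x,y)=\sum_{k,j=0}^\infty\alpha_r(k,j)x^ky^j.$$ These power series are expansions of rational functions, denoted by the same symbols; $F_r(1/x)$ and $F_r(1/x,1/y)$ are obtained by substitution in these rational functions, and the functional equations are identities of rational functions. *)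

theory Defs
  imports "HOL-Computational_Algebra.Computational_Algebra"
begin

definition c_seqs :: "nat \<Rightarrow> nat \<Rightarrow> int list set" where
  "c_seqs r k = {cs. length cs = r \<and> sorted cs \<and> (\<forall>c\<in>set cs. 0 \<le> c) \<and> sum_list cs = int k}"

text \<open>\<open>iter_sum d [c\<^sub>1, \<dots>, c\<^sub>r]\<close> is the iterated sum
  over \<open>d \<le> d\<^sub>1 \<le> c\<^sub>1\<close>, \<open>d\<^sub>1 \<le> d\<^sub>2 \<le> c\<^sub>2\<close>, \<dots>, \<open>d\<^sub>r\<^sub>-\<^sub>1 \<le> d\<^sub>r \<le> c\<^sub>r\<close> of 1.\<close>

fun iter_sum :: "int \<Rightarrow> int list \<Rightarrow> nat" where
  "iter_sum d [] = 1"
| "iter_sum d (c # cs) = (\<Sum>d' = d..c. iter_sum d' cs)"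

definition alpha2 :: "nat \<Rightarrow> nat \<Rightarrow> nat \<Rightarrow> nat" where
  "alpha2 r k j = (\<Sum>cs\<in>c_seqs r k. \<Sum>d\<^sub>0 = - int j..0. iter_sum d\<^sub>0 cs)"

definition alpha1 :: "nat \<Rightarrow> nat \<Rightarrow> nat" where
  "alpha1 r k = card {(cs, ds). cs \<in> c_seqs r k \<and> length ds = r \<and> sorted ds \<and>
     (\<forall>d\<in>set ds. 0 \<le> d) \<and> (\<forall>i<r. ds ! i \<le> cs ! i)}"

text \<open>Both index sets are finite, so neither \<^const>\<open>sum\<close> nor \<^const>\<open>card\<close> takes its
  default value.\<close>

lemma bounded_lists_finite: "finite {xs :: int list. length xs = r \<and> set xs \<subseteq> {0..m}}"
  using finite_lists_length_eq[of "{0..m}" r] by (simp add: conj_commute)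

lemma c_seqs_subset: "c_seqs r k \<subseteq> {xs. length xs = r \<and> set xs \<subseteq> {0..int k}}"
proof -
  have "c \<le> sum_list cs" if "c \<in> set cs" "\<forall>c\<in>set cs. 0 \<le> c" for c and cs :: "int list"
    using that by (induction cs) (auto simp: add_increasing add_increasing2 sum_list_nonneg)
  thus ?thesis by (fastforce simp: c_seqs_def)
qed

lemma finite_c_seqs: "finite (c_seqs r k)"
  using c_seqs_subset bounded_lists_finite by (rule finite_subset)

lemma finite_alpha1_set:
  "finite {(cs, ds). cs \<in> c_seqs r k \<and> length ds = r \<and> sorted ds \<and>
     (\<forall>d\<in>set ds. 0 \<le> d) \<and> (\<forall>i<r. ds ! i \<le> cs ! i)}"
proof (rule finite_subset)
  let ?L = "{xs. length xs = r \<and> set xs \<subseteq> {0..int k}}"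
  show "finite (?L \<times> ?L)" using bounded_lists_finite by blast
  have "set ds \<subseteq> {0..int k}"
    if *: "cs \<in> c_seqs r k" "length ds = r" "\<forall>d\<in>set ds. 0 \<le> d" "\<forall>i<r. ds ! i \<le> cs ! i" for cs ds
  proof
    fix d assume d: "d \<in> set ds"
    then obtain i where i: "i < r" "d = ds ! i" using *(2) by (metis in_set_conv_nth)
    have "cs ! i \<in> {0..int k}" using c_seqs_subset[of r k] *(1) i(1) by (force simp: subset_iff)
    thus "d \<in> {0..int k}" using i * d by fastforce
  qed
  thus "{(cs, ds). cs \<in> c_seqs r k \<and> length ds = r \<and> sorted ds \<and>
     (\<forall>d\<in>set ds. 0 \<le> d) \<and> (\<forall>i<r. ds ! i \<le> cs ! i)} \<subseteq> ?L \<times> ?L"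
    using c_seqs_subset by blast
qed

definition F1_series :: "nat \<Rightarrow> int fps" where
  "F1_series r = Abs_fps (\<lambda>k. int (alpha1 r k))"

text \<open>Bivariate series and polynomials have \<open>y\<close> as the outer and \<open>x\<close> as the inner variable.\<close>

definition F2_series :: "nat \<Rightarrow> int fps fps" where
  "F2_series r = Abs_fps (\<lambda>j. Abs_fps (\<lambda>k. int (alpha2 r k j)))"

text \<open>The fields \<open>\<rat>(x)\<close> and \<open>\<rat>(x, y)\<close> are represented as the fraction fields of
  \<open>\<int>[x]\<close> and \<open>\<int>[x][y]\<close>.\<close>

type_synonym ratfun1 = "int poly fract"
type_synonym ratfun2 = "int poly poly fract"

definition var_x1 :: ratfun1 where "var_x1 = to_fract [:0, 1:]"
definition var_x2 :: ratfun2 where "var_x2 = to_fract [:[:0, 1:]:]"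
definition var_y2 :: ratfun2 where "var_y2 = to_fract [:0, 1:]"

definition fps_of_poly2 :: "int poly poly \<Rightarrow> int fps fps" where
  "fps_of_poly2 p = fps_of_poly (map_poly fps_of_poly p)"

definition is_expansion1 :: "int fps \<Rightarrow> ratfun1 \<Rightarrow> bool" where
  "is_expansion1 F R \<longleftrightarrow>
     (\<exists>P Q. coeff Q 0 \<noteq> 0 \<and> R = Fract P Q \<and> fps_of_poly Q * F = fps_of_poly P)"

definition is_expansion2 :: "int fps fps \<Rightarrow> ratfun2 \<Rightarrow> bool" where
  "is_expansion2 F R \<longleftrightarrow>
     (\<exists>P Q. coeff (coeff Q 0) 0 \<noteq> 0 \<and> R = Fract P Q \<and> fps_of_poly2 Q * F = fps_of_poly2 P)"

definition F1 :: "nat \<Rightarrow> ratfun1" where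
  "F1 r = (THE R. is_expansion1 (F1_series r) R)"

definition F2 :: "nat \<Rightarrow> ratfun2" where
  "F2 r = (THE R. is_expansion2 (F2_series r) R)"

text \<open>A power series is the expansion of at most one rational function.\<close>

lemma fps_of_poly2_mult: "fps_of_poly2 (p * q) = fps_of_poly2 p * fps_of_poly2 q"
proof -
  have "map_poly fps_of_poly (p * q) = map_poly fps_of_poly p * map_poly fps_of_poly q"
    by (rule poly_eqI)
       (simp add: coeff_map_poly coeff_mult fps_of_poly_sum fps_of_poly_mult)
  thus ?thesis by (simp add: fps_of_poly2_def fps_of_poly_mult)
qed

lemma fps_of_poly2_eq_iff: "fps_of_poly2 p = fps_of_poly2 q \<longleftrightarrow> p = q"
  by (auto simp: fps_of_poly2_def fps_of_poly_eq_iff poly_eq_iff coeff_map_poly)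

lemma is_expansion1_unique:
  assumes "is_expansion1 F R" "is_expansion1 F R'"
  shows "R = R'"
proof -
  obtain P Q P' Q' where *: "Q \<noteq> 0" "R = Fract P Q" "fps_of_poly Q * F = fps_of_poly P"
    "Q' \<noteq> 0" "R' = Fract P' Q'" "fps_of_poly Q' * F = fps_of_poly P'"
    using assms unfolding is_expansion1_def by (metis coeff_0)
  have "fps_of_poly (P * Q') = fps_of_poly (P' * Q)"
    by (simp add: fps_of_poly_mult flip: *(3,6))
  thus ?thesis using * by (simp add: fps_of_poly_eq_iff eq_fract)
qed

lemma is_expansion2_unique:
  assumes "is_expansion2 F R" "is_expansion2 F R'"
  shows "R = R'"
proof -
  obtain P Q P' Q' where *: "Q \<noteq> 0" "R = Fract P Q" "fps_of_poly2 Q * F = fps_of_poly2 P"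
    "Q' \<noteq> 0" "R' = Fract P' Q'" "fps_of_poly2 Q' * F = fps_of_poly2 P'"
    using assms unfolding is_expansion2_def by (metis coeff_0)
  have "fps_of_poly2 (P * Q') = fps_of_poly2 (P' * Q)"
    by (simp add: fps_of_poly2_mult flip: *(3,6))
  thus ?thesis using * by (simp add: fps_of_poly2_eq_iff eq_fract)
qed

definition eval1 :: "int poly \<Rightarrow> 'a::field \<Rightarrow> 'a" where
  "eval1 p u = poly (map_poly of_int p) u"

definition eval2 :: "int poly poly \<Rightarrow> 'a::field \<Rightarrow> 'a \<Rightarrow> 'a" where
  "eval2 p u v = poly (map_poly (\<lambda>q. eval1 q u) p) v"

definition subst1 :: "ratfun1 \<Rightarrow> 'a::field \<Rightarrow> 'a" where
  "subst1 R u = (case quot_of_fract R of (P, Q) \<Rightarrow> eval1 P u / eval1 Q u)"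

definition subst2 :: "ratfun2 \<Rightarrow> 'a::field \<Rightarrow> 'a \<Rightarrow> 'a" where
  "subst2 R u v = (case quot_of_fract R of (P, Q) \<Rightarrow> eval2 P u v / eval2 Q u v)"

text \<open>The choice of the reduced fraction is immaterial: the value is the quotient of the values of
  any numerator and denominator, as long as the denominator does not vanish.\<close>

lemma poly_map_poly_mult:
  fixes f :: "'b::comm_ring_1 \<Rightarrow> 'a::field"
  assumes [simp]: "f 0 = 0" and add: "\<And>a b. f (a + b) = f a + f b"
    and mult: "\<And>a b. f (a * b) = f a * f b"
  shows "poly (map_poly f (p * q)) x = poly (map_poly f p) x * poly (map_poly f q) x"
proof -
  have sum: "f (sum g A) = (\<Sum>i\<in>A. f (g i))" if "finite A" for g :: "nat \<Rightarrow> 'b" and A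
    using that by (induction A rule: finite_induct) (simp_all add: add)
  have "map_poly f (p * q) = map_poly f p * map_poly f q"
    by (rule poly_eqI) (simp add: coeff_map_poly coeff_mult sum mult)
  thus ?thesis by simp
qed

lemma eval1_0 [simp]: "eval1 0 u = 0"
  by (simp add: eval1_def)

lemma eval1_add: "eval1 (p + q) u = eval1 p u + eval1 q u"
proof -
  have "map_poly of_int (p + q) = (map_poly of_int p + map_poly of_int q :: 'a poly)"
    by (rule poly_eqI) (simp add: coeff_map_poly)
  thus ?thesis by (simp add: eval1_def)
qed

lemma eval1_mult: "eval1 (p * q) u = eval1 p u * eval1 q u"
  unfolding eval1_def by (rule poly_map_poly_mult) simp_all

lemma eval2_mult: "eval2 (p * q) u v = eval2 p u v * eval2 q u v"
  unfolding eval2_def by (rule poly_map_poly_mult) (simp_all add: eval1_add eval1_mult)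

lemma quot_of_fract_FractE:
  assumes "Q \<noteq> 0"
  obtains P' Q' d where "quot_of_fract (Fract P Q) = (P', Q')" "P = P' * d" "Q = Q' * d"
proof -
  have "quot_of_fract (Fract P Q) = normalize_quot (P, Q)"
    using quot_of_fract_quot_to_fract[of "(P, Q)"] by (simp add: quot_to_fract_def)
  thus ?thesis using normalize_quotE[of Q P] assms that by (metis prod.collapse)
qed

lemma subst1_Fract: "eval1 Q u \<noteq> 0 \<Longrightarrow> subst1 (Fract P Q) u = eval1 P u / eval1 Q u"
  by (cases "Q = 0", simp, rule quot_of_fract_FractE[of Q P])
     (auto simp: subst1_def eval1_mult)

lemma subst2_Fract: "eval2 Q u v \<noteq> 0 \<Longrightarrow> subst2 (Fract P Q) u v = eval2 P u v / eval2 Q u v"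
  by (cases "Q = 0", simp add: eval2_def, rule quot_of_fract_FractE[of Q P])
     (auto simp: subst2_def eval2_mult)

text \<open>No nonzero polynomial vanishes at the points that are substituted below.\<close>

definition rev_poly :: "nat \<Rightarrow> (nat \<Rightarrow> 'a::comm_ring_1) \<Rightarrow> 'a poly" where
  "rev_poly n c = (\<Sum>i\<le>n. monom (c i) (n - i))"

lemma coeff_rev_poly:
  assumes "k \<le> n"
  shows "coeff (rev_poly n c) (n - k) = c k"
proof -
  have "coeff (rev_poly n c) (n - k) = (\<Sum>i\<le>n. if i = k then c i else 0)"
    unfolding rev_poly_def coeff_sum using assms by (intro sum.cong) auto
  thus ?thesis using assms by simp
qed

lemma poly_map_poly_inverse:
  fixes z :: "'a::field"
  assumes "degree p \<le> n" "f 0 = 0" "z \<noteq> 0"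
  shows "poly (map_poly f p) (1 / z) * z ^ n = (\<Sum>i\<le>n. f (coeff p i) * z ^ (n - i))"
proof -
  have "poly (map_poly f p) (1 / z) = (\<Sum>i\<le>n. coeff (map_poly f p) i * (1 / z) ^ i)"
    unfolding poly_altdef using assms map_poly_degree_leq[of f p]
    by (intro sum.mono_neutral_left) (auto simp: coeff_eq_0)
  thus ?thesis
    using assms by (simp add: sum_distrib_right coeff_map_poly power_diff power_one_over)
qed

lemma to_fract_power: "to_fract (a ^ n) = to_fract a ^ n"
  by (induction n) simp_all

lemma to_fract_of_nat: "to_fract (of_nat n) = of_nat n"
  by (induction n) simp_all

lemma to_fract_of_int: "to_fract (of_int n) = of_int n"
  by (cases n rule: int_cases2) (simp_all add: to_fract_of_nat)

lemma to_fract_monom1: "to_fract (monom c n) = of_int c * var_x1 ^ n"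
proof -
  have "monom c n = of_int c * [:0, 1:] ^ n"
    by (simp add: monom_altdef of_int_poly)
  thus ?thesis by (simp add: to_fract_power to_fract_of_int var_x1_def)
qed

lemma to_fract_monom2_const: "to_fract [:monom c n:] = of_int c * var_x2 ^ n"
proof -
  have "[:monom c n:] = of_int c * [:[:0, 1:]:] ^ n"
  proof (induction n)
    case (Suc n)
    have "[:monom c (Suc n):] = [:[:0, 1:]:] * [:monom c n:]"
      by (simp add: monom_Suc)
    also have "\<dots> = of_int c * [:[:0, 1:]:] ^ Suc n"
      by (simp only: Suc power_Suc mult.left_commute)
    finally show ?case .
  qed (simp add: monom_0 of_int_poly)
  thus ?thesis by (simp add: to_fract_power to_fract_of_int var_x2_def)
qed

lemma to_fract_monom2: "to_fract (monom p n) = to_fract [:p:] * var_y2 ^ n"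
proof -
  have "monom p n = [:p:] * [:0, 1:] ^ n" by (simp add: monom_altdef)
  thus ?thesis by (simp only: to_fract_power to_fract_mult var_y2_def)
qed

lemma var_nonzero [simp]: "var_x1 \<noteq> 0" "var_x2 \<noteq> 0" "var_y2 \<noteq> 0"
  by (simp_all add: var_x1_def var_x2_def var_y2_def)

lemma eval1_inverse_nonzero:
  assumes "Q \<noteq> 0"
  shows "eval1 Q (1 / var_x1) \<noteq> 0"
proof
  assume zero: "eval1 Q (1 / var_x1) = 0"
  let ?n = "degree Q"
  have "to_fract (rev_poly ?n (coeff Q)) = eval1 Q (1 / var_x1) * var_x1 ^ ?n"
    by (simp add: eval1_def poly_map_poly_inverse rev_poly_def to_fract_monom1)
  hence "rev_poly ?n (coeff Q) = 0" using zero by simp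
  thus False using coeff_rev_poly[of ?n ?n "coeff Q"] assms by simp
qed

lemma eval2_inverse_nonzero:
  assumes "Q \<noteq> 0"
  shows "eval2 Q (1 / var_x2) (1 / var_y2) \<noteq> 0"
proof
  assume zero: "eval2 Q (1 / var_x2) (1 / var_y2) = 0"
  let ?m = "degree Q"
  define n where "n = (\<Sum>j\<le>?m. degree (coeff Q j))"
  define b where "b j = rev_poly n (coeff (coeff Q j))" for j
  have deg: "degree (coeff Q j) \<le> n" if "j \<le> ?m" for j
    unfolding n_def using that by (intro member_le_sum) auto
  have const_sum: "[:sum g A:] = (\<Sum>i\<in>A. [:g i:])" for g :: "nat \<Rightarrow> int poly" and A
  proof (induction A rule: infinite_finite_induct)
    case (insert x A)
    have "[:sum g (insert x A):] = [:g x:] + [:sum g A:]" by (simp add: insert.hyps)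
    thus ?case by (simp only: insert.IH sum.insert[OF insert.hyps])
  qed simp_all
  have b: "to_fract [:b j:] = eval1 (coeff Q j) (1 / var_x2) * var_x2 ^ n" if "j \<le> ?m" for j
    by (simp add: b_def eval1_def poly_map_poly_inverse deg[OF that] rev_poly_def const_sum
        to_fract_monom2_const)
  have "to_fract (rev_poly ?m b) = (\<Sum>j\<le>?m. to_fract [:b j:] * var_y2 ^ (?m - j))"
    by (simp add: rev_poly_def to_fract_monom2)
  also have "\<dots> = (\<Sum>j\<le>?m. eval1 (coeff Q j) (1 / var_x2) * var_y2 ^ (?m - j)) * var_x2 ^ n"
    unfolding sum_distrib_right by (intro sum.cong) (simp_all add: b)
  also have "\<dots> = eval2 Q (1 / var_x2) (1 / var_y2) * var_y2 ^ ?m * var_x2 ^ n"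
    by (simp add: eval2_def poly_map_poly_inverse)
  finally have "rev_poly ?m b = 0" using zero by simp
  hence "b ?m = 0" using coeff_rev_poly[of ?m ?m b] by simp
  hence "coeff (coeff Q ?m) (degree (coeff Q ?m)) = 0"
    using coeff_rev_poly[OF deg, of ?m "coeff (coeff Q ?m)"] by (simp add: b_def)
  thus False using assms by simp
qed

end

theory Submission
  imports Defs
begin

text \<open>
  After the shift by \<open>j\<close>, both series count pairs of weakly increasing sequences
  \<open>d\<^sub>i \<le> c\<^sub>i\<close> of \<open>n\<close> natural numbers, i.e. partitions of the poset \<open>2 \<times> n\<close>. Let \<open>u\<^sub>q\<close> mark the
  increment of \<open>c\<close> that moves the last \<open>q\<close> of the \<open>c\<^sub>i\<close>. If \<open>G p q\<close> counts the partitions in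
  which only the last \<open>p\<close> of the \<open>d\<^sub>i\<close> and the last \<open>q\<close> of the \<open>c\<^sub>i\<close> remain, inclusion-exclusion
  over the minimal elements with value \<open>0\<close> gives, for \<open>p < q\<close>,
  \<open>(1 - u\<^sub>q) G p q = G (p-1) q + G p (q-1) - G (p-1) (q-1)\<close>, and for \<open>p = q\<close> the last two terms
  are absent. The recursion implies by induction
  \<open>G p q (1/u) = (-1)\<^sup>p\<^sup>+\<^sup>q u\<^sub>1 \<cdots> u\<^sub>q [t\<^sup>p] (1 - t)\<^sup>1\<^sup>-\<^sup>q\<^sup>+\<^sup>p (\<Sum>i. G i q t\<^sup>i)\<close>.
  On the diagonal this becomes \<open>G n n (1/u) = u\<^sub>1 \<cdots> u\<^sub>n u\<^sub>n G n n (u)\<close>. Equation (ii) is the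
  case \<open>n = r\<close>, \<open>u\<^sub>q = x\<^sup>q\<close>; equation (i) is the case \<open>n = r + 1\<close>, \<open>u\<^sub>q = x\<^sup>q\<close> for \<open>q \<le> r\<close> and
  \<open>u\<^sub>r\<^sub>+\<^sub>1 = y\<close>.
\<close>

section \<open>The grid recursion and inversion of its weights\<close>

context
  fixes u :: "nat \<Rightarrow> 'a::field"
begin

fun grid_gf :: "nat \<Rightarrow> nat \<Rightarrow> 'a" where
  "grid_gf 0 0 = 1"
| "grid_gf 0 (Suc q) = grid_gf 0 q / (1 - u (Suc q))"
| "grid_gf (Suc p) 0 = 0"
| "grid_gf (Suc p) (Suc q) =
     (if p < q then grid_gf p (Suc q) + grid_gf (Suc p) q - grid_gf p q
      else if p = q then grid_gf p (Suc q) else 0) / (1 - u (Suc q))"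

end

definition grid_row :: "(nat \<Rightarrow> 'a::field) \<Rightarrow> nat \<Rightarrow> 'a fps" where
  "grid_row u q = Abs_fps (\<lambda>p. grid_gf u p q)"

lemma grid_row_nth [simp]: "grid_row u q $ p = grid_gf u p q"
  by (simp add: grid_row_def)

text \<open>Multiplied out, the recursion compares coefficients of products with t =
  \<open>fps_X\<close>. The comparison stops at degree \<open>q\<close>: coefficient
  \<open>Suc q\<close> of the new row obeys the diagonal rule, which lacks two terms.\<close>

lemma grid_row_Suc:
  assumes "u (Suc q) \<noteq> 1" "p \<le> q"
  shows "((fps_const (1 - u (Suc q)) - fps_X) * grid_row u (Suc q)) $ p
       = ((1 - fps_X) * grid_row u q) $ p"
  using assms by (cases p) (auto simp: algebra_simps divide_simps)

lemma fps_mult_nth_cong: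
  fixes f g h :: "'a::comm_ring_1 fps"
  assumes "\<And>i. i \<le> n \<Longrightarrow> f $ i = g $ i"
  shows "(f * h) $ n = (g * h) $ n"
  unfolding fps_mult_nth by (intro sum.cong) (auto simp: assms)

text \<open>The factor \<open>(1 - fps_X) * inverse (1 - fps_X) ^ (q - p)\<close> is (1 - t)^(1 - q
  + p), written with natural exponents. The induction follows the recursion for the weights 1/u,
  where \<open>1 - 1 / v = - (1 - v) / v\<close>.\<close>

lemma grid_gf_inverse:
  fixes u :: "nat \<Rightarrow> 'a::field"
  assumes "\<And>i. 1 \<le> i \<Longrightarrow> i \<le> n \<Longrightarrow> u i \<noteq> 0 \<and> u i \<noteq> 1"
    and "p \<le> q" "q \<le> n"
  shows "grid_gf (\<lambda>i. 1 / u i) p q = (-1) ^ (p + q) * (\<Prod>i=1..q. u i) *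
    ((1 - fps_X) * grid_row u q * inverse (1 - fps_X) ^ (q - p)) $ p"
  using assms(2,3)
proof (induction p q rule: grid_gf.induct)
  case 1
  show ?case by simp
next
  case (2 q)
  have u: "u (Suc q) \<noteq> 0" "u (Suc q) \<noteq> 1" using assms(1)[of "Suc q"] 2 by auto
  have h: "grid_gf (\<lambda>i. 1 / u i) 0 q = (-1) ^ q * (\<Prod>i=1..q. u i) * grid_gf u 0 q"
    using 2 by (simp add: fps_power_zeroth)
  show ?case using u by (simp add: h fps_power_zeroth) (simp add: field_simps)
next
  case (3 p)
  thus ?case by simp
next
  case (4 p q)
  define v where "v = u (Suc q)"
  have u: "v \<noteq> 0" "v \<noteq> 1" using assms(1)[of "Suc q"] 4 by (auto simp: v_def)
  define U where "U = (\<Prod>i=1..q. u i)"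
  have U: "(\<Prod>i=1..Suc q. u i) = U * v" by (simp add: U_def v_def)
  define B :: "'a fps" where "B = inverse (1 - fps_X)"
  define G where "G = grid_row u (Suc q)"
  define H where "H = grid_row u q"
  have B: "(1 - fps_X) * B = 1" unfolding B_def by (rule inverse_mult_eq_1') simp
  show ?case
  proof (cases "p < q")
    case True
    define k where "k = q - Suc p"
    have k: "Suc q - p = Suc (Suc k)" "Suc q - Suc p = Suc k" "q - Suc p = k" "q - p = Suc k"
      using True by (auto simp: k_def)
    have h1: "grid_gf (\<lambda>i. 1 / u i) p (Suc q) = (-1) ^ (p + Suc q) * (U * v) *
        ((1 - fps_X) * G * B ^ Suc (Suc k)) $ p"
      using 4 True by (simp only: U k B_def[symmetric] G_def[symmetric])
    have h2: "grid_gf (\<lambda>i. 1 / u i) (Suc p) q = (-1) ^ (Suc p + q) * U *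
        ((1 - fps_X) * H * B ^ k) $ Suc p"
      using 4 True by (simp add: k U_def B_def H_def)
    have h3: "grid_gf (\<lambda>i. 1 / u i) p q = (-1) ^ (p + q) * U *
        ((1 - fps_X) * H * B ^ Suc k) $ p"
      using 4 True by (simp add: k U_def B_def H_def)
    \<comment> \<open>Writing \<open>B ^ k\<close> as \<open>(1 - fps_X) * B ^ Suc k\<close> merges
      the two contributions of row \<open>q\<close> into one coefficient, to which the relation
      between the rows applies.\<close>
    have "(1 - fps_X) * H * B ^ k = (1 - fps_X) * H * B ^ k * ((1 - fps_X) * B)"
      by (simp add: B)
    hence "(1 - fps_X) * H * B ^ k + fps_X * ((1 - fps_X) * H * B ^ Suc k)
        = (1 - fps_X) * H * B ^ Suc k" by (simp add: algebra_simps)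
    hence "((1 - fps_X) * H * B ^ k) $ Suc p + ((1 - fps_X) * H * B ^ Suc k) $ p
        = ((1 - fps_X) * H * B ^ Suc k) $ Suc p"
      by (metis fps_add_nth fps_X_mult_nth nat.distinct(1) diff_Suc_1)
    \<comment> \<open>Coefficient \<open>Suc p\<close> only involves degrees up to
      \<open>Suc p \<le> q\<close>, the range of \<open>grid_row_Suc\<close>.\<close>
    also have "\<dots> = ((fps_const (1 - v) - fps_X) * G * B ^ Suc k) $ Suc p"
      using grid_row_Suc[of u q] u True
      by (intro fps_mult_nth_cong) (simp add: v_def G_def H_def)
    finally have row: "((1 - fps_X) * H * B ^ k) $ Suc p + ((1 - fps_X) * H * B ^ Suc k) $ p
        = ((fps_const (1 - v) - fps_X) * G * B ^ Suc k) $ Suc p" .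
    have "fps_X * ((1 - fps_X) * G * B ^ Suc (Suc k)) = fps_X * G * B ^ Suc k * ((1 - fps_X) * B)"
      by (simp add: algebra_simps)
    hence "((1 - fps_X) * G * B ^ Suc (Suc k)) $ p = (fps_X * G * B ^ Suc k) $ Suc p"
      by (metis B mult.right_neutral fps_X_mult_nth nat.distinct(1) diff_Suc_1)
    hence "v * ((1 - fps_X) * G * B ^ Suc (Suc k)) $ p
        + (((1 - fps_X) * H * B ^ k) $ Suc p + ((1 - fps_X) * H * B ^ Suc k) $ p)
        = (fps_const v * (fps_X * G * B ^ Suc k)
           + (fps_const (1 - v) - fps_X) * G * B ^ Suc k) $ Suc p"
      by (simp add: row del: power_Suc)
    \<comment> \<open>This is v t + (1 - v - t) = (1 - v)(1 - t).\<close>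
    also have "fps_const v * (fps_X * G * B ^ Suc k) + (fps_const (1 - v) - fps_X) * G * B ^ Suc k
        = fps_const (1 - v) * ((1 - fps_X) * G * B ^ Suc k)"
      by (simp add: algebra_simps flip: fps_const_sub)
    finally have key: "v * ((1 - fps_X) * G * B ^ Suc (Suc k)) $ p
        + (((1 - fps_X) * H * B ^ k) $ Suc p + ((1 - fps_X) * H * B ^ Suc k) $ p)
        = (1 - v) * ((1 - fps_X) * G * B ^ Suc k) $ Suc p"
      by simp
    have "grid_gf (\<lambda>i. 1 / u i) (Suc p) (Suc q) =
      (grid_gf (\<lambda>i. 1 / u i) p (Suc q) + grid_gf (\<lambda>i. 1 / u i) (Suc p) q
        - grid_gf (\<lambda>i. 1 / u i) p q) / (1 - 1 / v)"
      using True by (simp add: v_def)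
    \<comment> \<open>All three terms carry the same sign: \<open>p + q\<close> grows by one in the
      first two, and the third is subtracted.\<close>
    also have "\<dots> = - ((-1) ^ (p + q) * U *
        (v * ((1 - fps_X) * G * B ^ Suc (Suc k)) $ p
        + (((1 - fps_X) * H * B ^ k) $ Suc p + ((1 - fps_X) * H * B ^ Suc k) $ p))) / (1 - 1 / v)"
      unfolding h1 h2 h3 by (simp add: algebra_simps del: power_Suc) (simp add: algebra_simps)
    also have "\<dots> = (-1) ^ (p + q) * U * v * ((1 - fps_X) * G * B ^ Suc k) $ Suc p"
      unfolding key using u by (simp add: field_simps del: power_Suc)
    finally have "grid_gf (\<lambda>i. 1 / u i) (Suc p) (Suc q)
      = (-1) ^ (Suc p + Suc q) * (U * v) * ((1 - fps_X) * G * B ^ Suc k) $ Suc p"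
      by (simp del: grid_gf.simps)
    thus ?thesis by (simp only: U k B_def G_def)
  next
    case False
    hence pq: "p = q" using 4 by simp
    have "grid_gf (\<lambda>i. 1 / u i) q (Suc q) = - (U * v) * ((1 - fps_X) * G * B) $ q"
      using 4 pq by (simp add: U_def v_def B_def G_def)
    also have "(1 - fps_X) * G * B = G * ((1 - fps_X) * B)" by (simp add: algebra_simps)
    finally have h: "grid_gf (\<lambda>i. 1 / u i) q (Suc q) = - (U * v) * grid_gf u q (Suc q)"
      by (simp add: B G_def)
    have "grid_gf (\<lambda>i. 1 / u i) (Suc q) (Suc q) = U * v * (v * (grid_gf u q (Suc q) / (1 - v)))"
      using u by (simp add: h divide_simps flip: v_def) (simp add: algebra_simps)
    \<comment> \<open>By the diagonal rule both sides are v G(q+1, q+1) = G(q+1, q+1) - G(q,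
      q+1).\<close>
    also have "v * (grid_gf u q (Suc q) / (1 - v)) = ((1 - fps_X) * G) $ Suc q"
      using u by (simp add: G_def left_diff_distrib field_simps flip: v_def)
    finally show ?thesis by (simp add: pq U_def v_def G_def)
  qed
qed

text \<open>For p = q = n the coefficient of t^n is G(n, n) - G(n-1, n), which the diagonal rule
  turns into u_n G(n, n). For n = 0 the extra factor is \<open>u 0\<close>, outside the range of the
  product; hence the second premise.\<close>

lemma grid_gf_inverse_diag:
  fixes u :: "nat \<Rightarrow> 'a::field"
  assumes "\<And>i. 1 \<le> i \<Longrightarrow> i \<le> n \<Longrightarrow> u i \<noteq> 0 \<and> u i \<noteq> 1" "n = 0 \<Longrightarrow> u 0 = 1"
  shows "grid_gf (\<lambda>i. 1 / u i) n n = (\<Prod>i=1..n. u i) * u n * grid_gf u n n"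
proof (cases n)
  case (Suc q)
  have "u n \<noteq> 1" using assms(1)[of n] Suc by simp
  hence "((1 - fps_X) * grid_row u n) $ n = u n * grid_gf u n n"
    by (simp add: Suc left_diff_distrib field_simps)
  thus ?thesis
    using grid_gf_inverse[where u=u and n=n and p=n and q=n] assms(1) by simp
qed (use assms in simp)

section \<open>Transfer of the recursion along homomorphisms and relations\<close>

lemma grid_gf_hom:
  fixes \<phi> :: "'a::field \<Rightarrow> 'b::field"
  assumes add: "\<And>a b. \<phi> (a + b) = \<phi> a + \<phi> b" and mult: "\<And>a b. \<phi> (a * b) = \<phi> a * \<phi> b"
    and one: "\<phi> 1 = 1"
  shows "\<phi> (grid_gf u p q) = grid_gf (\<lambda>i. \<phi> (u i)) p q"
proof -
  have zero: "\<phi> 0 = 0" using add[of 0 0] by (metis add_0_right add_left_cancel)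
  have diff: "\<phi> (a - b) = \<phi> a - \<phi> b" for a b
    using add[of "a - b" b] by simp
  \<comment> \<open>A nonzero \<open>b\<close> has nonzero image because its inverse is mapped to an
    inverse; for \<open>b = 0\<close> both quotients are 0 by convention.\<close>
  have divide: "\<phi> (a / b) = \<phi> a / \<phi> b" for a b
  proof (cases "b = 0")
    case False
    have "\<phi> (inverse b) * \<phi> b = 1" using mult[of "inverse b" b] False one by simp
    hence "\<phi> (inverse b) = 1 / \<phi> b"
      by (metis mult_zero_right nonzero_eq_divide_eq zero_neq_one)
    thus ?thesis by (simp add: divide_inverse mult)
  qed (simp add: zero)
  show ?thesis
    by (induction p q rule: grid_gf.induct) (simp_all add: zero one diff divide add)
qed

text \<open>\<open>R\<close> will be the relation between a power series and the rational function it expands.\<close>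

lemma grid_gf_rel:
  fixes e :: "nat \<Rightarrow> nat \<Rightarrow> 'b::comm_ring_1" and u :: "nat \<Rightarrow> 'a::field"
  assumes one: "R 1 1"
    and add: "\<And>a b a' b'. R a b \<Longrightarrow> R a' b' \<Longrightarrow> R (a + a') (b + b')"
    and diff: "\<And>a b a' b'. R a b \<Longrightarrow> R a' b' \<Longrightarrow> R (a - a') (b - b')"
    and divide: "\<And>q a b. 1 \<le> q \<Longrightarrow> q \<le> n \<Longrightarrow> R ((1 - v q) * a) b \<Longrightarrow> R a (b / (1 - u q))"
    and e0: "e 0 0 = 1"
    and e1: "\<And>q. Suc q \<le> n \<Longrightarrow> (1 - v (Suc q)) * e 0 (Suc q) = e 0 q"
    and e2: "\<And>p q. Suc q \<le> n \<Longrightarrow> p < q \<Longrightarrow>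
      (1 - v (Suc q)) * e (Suc p) (Suc q) = e p (Suc q) + e (Suc p) q - e p q"
    and e3: "\<And>q. Suc q \<le> n \<Longrightarrow> (1 - v (Suc q)) * e (Suc q) (Suc q) = e q (Suc q)"
    and "p \<le> q" "q \<le> n"
  shows "R (e p q) (grid_gf u p q)"
  using assms(9,10)
proof (induction p q rule: grid_gf.induct)
  case 1
  show ?case by (simp add: e0 one)
next
  case (2 q)
  hence "R ((1 - v (Suc q)) * e 0 (Suc q)) (grid_gf u 0 q)" by (simp add: e1)
  thus ?case using divide[of "Suc q"] 2 by simp
next
  case (3 p)
  thus ?case by simp
next
  case (4 p q)
  have "R ((1 - v (Suc q)) * e (Suc p) (Suc q))
    (if p < q then grid_gf u p (Suc q) + grid_gf u (Suc p) q - grid_gf u p q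
     else grid_gf u p (Suc q))"
  proof (cases "p < q")
    case True
    thus ?thesis using 4 by (simp add: e2) (intro add diff; simp)
  next
    case False
    hence "p = q" using 4 by simp
    thus ?thesis using 4 by (simp add: e3)
  qed
  thus ?case using divide[of "Suc q"] 4 by (auto split: if_splits)
qed

section \<open>Weakly increasing sequences and the recursion in one variable\<close>

definition c_gf :: "nat \<Rightarrow> (int list \<Rightarrow> nat) \<Rightarrow> int fps" where
  "c_gf q f = Abs_fps (\<lambda>m. \<Sum>cs\<in>c_seqs q m. int (f cs))"

lemma c_gf_add: "c_gf q (\<lambda>cs. f cs + g cs) = c_gf q f + c_gf q g"
  by (rule fps_ext) (simp add: c_gf_def sum.distrib)

lemma c_gf_cong:
  assumes "\<And>cs. length cs = q \<Longrightarrow> sorted cs \<Longrightarrow> \<forall>c\<in>set cs. 0 \<le> c \<Longrightarrow> f cs = g cs"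
  shows "c_gf q f = c_gf q g"
  unfolding c_gf_def by (intro arg_cong[of _ _ Abs_fps] ext sum.cong) (auto simp: c_seqs_def assms)

text \<open>The first entry is the smallest. Either it is 0 and can be removed, or all
  \<open>Suc q\<close> entries are positive and subtracting 1 from each lowers the sum by
  \<open>Suc q\<close>.\<close>

lemma c_seqs_Suc:
  "c_seqs (Suc q) m = (#) 0 ` c_seqs q m \<union>
     (if Suc q \<le> m then map ((+) 1) ` c_seqs (Suc q) (m - Suc q) else {})"
  (is "?L = ?A \<union> ?B")
proof (intro equalityI subsetI)
  fix cs assume cs: "cs \<in> ?L"
  then obtain c cs' where [simp]: "cs = c # cs'" by (cases cs) (auto simp: c_seqs_def)
  show "cs \<in> ?A \<union> ?B"
  proof (cases "c = 0")
    case True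
    thus ?thesis using cs by (auto simp: c_seqs_def)
  next
    case False
    hence ge: "\<forall>x\<in>set cs. 1 \<le> x" using cs by (force simp: c_seqs_def)
    define ds where "ds = map (\<lambda>x. x - 1) cs"
    have eq: "cs = map ((+) 1) ds" by (simp add: ds_def comp_def)
    have len: "length ds = Suc q" using cs by (simp add: ds_def c_seqs_def)
    have nn: "\<forall>x\<in>set ds. 0 \<le> x" using ge by (auto simp: ds_def)
    have sum: "int m = sum_list ds + int (Suc q)"
      using cs len unfolding eq c_seqs_def by (simp add: sum_list_addf sum_list_triv)
    hence le: "Suc q \<le> m" using sum_list_nonneg[of ds] nn by auto
    have "sorted cs" using cs by (simp only: c_seqs_def mem_Collect_eq)
    hence "sorted (map ((+) 1) ds)" by (simp only: eq)
    hence "sorted ds" by (simp add: sorted_map)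
    hence "ds \<in> c_seqs (Suc q) (m - Suc q)" using len nn sum le by (simp add: c_seqs_def)
    thus ?thesis using le eq by auto
  qed
next
  fix cs assume "cs \<in> ?A \<union> ?B"
  thus "cs \<in> ?L"
    by (auto simp: c_seqs_def sorted_map sum_list_addf sum_list_triv split: if_splits)
qed

lemma c_gf_Suc:
  "c_gf (Suc q) f = c_gf q (\<lambda>cs. f (0 # cs))
     + fps_X ^ Suc q * c_gf (Suc q) (\<lambda>cs. f (map ((+) 1) cs))"
proof (rule fps_ext)
  fix m
  have 1: "(\<Sum>cs\<in>(#) 0 ` c_seqs q m. int (f cs)) = (\<Sum>cs\<in>c_seqs q m. int (f (0 # cs)))"
    by (subst sum.reindex) auto
  have 2: "(\<Sum>cs\<in>map ((+) 1) ` A. int (f cs)) = (\<Sum>cs\<in>A. int (f (map ((+) 1) cs)))"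
    for A :: "int list set"
    by (subst sum.reindex) (auto intro!: inj_onI simp: map_injective)
  have 3: "(#) 0 ` c_seqs q m \<inter> map ((+) 1) ` c_seqs (Suc q) (m - Suc q) = {}"
    by (force simp: c_seqs_def Cons_eq_map_conv)
  show "c_gf (Suc q) f $ m = (c_gf q (\<lambda>cs. f (0 # cs))
     + fps_X ^ Suc q * c_gf (Suc q) (\<lambda>cs. f (map ((+) 1) cs))) $ m"
    using 3 by (auto simp: c_gf_def fps_X_power_mult_nth c_seqs_Suc[of q m] sum.union_disjoint 1 2
      finite_c_seqs simp del: power_Suc)
qed

lemma iter_sum_Cons:
  "d \<le> c \<Longrightarrow> iter_sum d (c # cs) = iter_sum d cs + iter_sum (d + 1) (c # cs)"
proof -
  assume "d \<le> c"
  hence "{d..c} = insert d {d + 1..c}" by auto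
  thus ?thesis by simp
qed

text \<open>The upper bound \<open>cs ! k\<close> is at least \<open>0 \<ge> d\<close>, so the first
  remaining variable can take the value \<open>d\<close>; fixing it there removes it.\<close>

lemma iter_sum_drop:
  assumes "length cs = q" "\<forall>c\<in>set cs. 0 \<le> c" "k < q" "d \<le> 0"
  shows "iter_sum d (drop k cs) = iter_sum d (drop (Suc k) cs) + iter_sum (d + 1) (drop k cs)"
proof -
  have "drop k cs = cs ! k # drop (Suc k) cs" using assms by (simp add: Cons_nth_drop_Suc)
  moreover have "d \<le> cs ! k" using assms by (force simp: in_set_conv_nth)
  ultimately show ?thesis by (metis iter_sum_Cons)
qed

lemma iter_sum_shift: "iter_sum (d + 1) (map ((+) 1) cs) = iter_sum d cs"
proof (induction cs arbitrary: d)
  case (Cons c cs)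
  have "iter_sum (d + 1) (map ((+) 1) (c # cs))
      = (\<Sum>d'\<in>(\<lambda>x. x + 1) ` {d..c}. iter_sum d' (map ((+) 1) cs))"
    by (simp add: add.commute)
  also have "\<dots> = iter_sum d (c # cs)"
    by (subst sum.reindex) (simp_all add: Cons)
  finally show ?case .
qed simp

text \<open>This is the entry G(p, q) for the weights x^i as a power series: all \<open>q\<close> of
  the c are kept, and only the last \<open>p\<close> of them bound a d.\<close>

definition grid_series :: "nat \<Rightarrow> nat \<Rightarrow> int fps" where
  "grid_series p q = c_gf q (\<lambda>cs. iter_sum 0 (drop (q - p) cs))"

lemma grid_series_0_0: "grid_series 0 0 = 1"
  proof (rule fps_ext)
  fix m
  have "c_seqs 0 m = (if m = 0 then {[]} else {})" by (auto simp: c_seqs_def)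
  thus "grid_series 0 0 $ m = 1 $ m" by (simp add: grid_series_def c_gf_def)
qed

lemma grid_series_0: "grid_series 0 q = c_gf q (\<lambda>_. 1)"
  unfolding grid_series_def by (rule c_gf_cong) simp

lemma grid_series_0_Suc: "(1 - fps_X ^ Suc q) * grid_series 0 (Suc q) = grid_series 0 q"
  using c_gf_Suc[of q "\<lambda>_. 1"] by (simp add: grid_series_0 algebra_simps)

text \<open>If the first remaining d is 0, it is removed. Otherwise all remaining d are at least 1.
  Then c_1 = 0 gives the last term, while for positive c_1 subtracting 1 from all c and d returns
  the original series with factor x^(q+1).\<close>

lemma grid_series_step:
  assumes "k < Suc q"
  shows "(1 - fps_X ^ Suc q) * c_gf (Suc q) (\<lambda>cs. iter_sum 0 (drop k cs))
    = c_gf (Suc q) (\<lambda>cs. iter_sum 0 (drop (Suc k) cs)) + c_gf q (\<lambda>cs. iter_sum 1 (drop k (0 # cs)))"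
proof -
  have "c_gf (Suc q) (\<lambda>cs. iter_sum 0 (drop k cs))
    = c_gf (Suc q) (\<lambda>cs. iter_sum 0 (drop (Suc k) cs) + iter_sum 1 (drop k cs))"
    using assms iter_sum_drop[where d=0] by (intro c_gf_cong) force
  also have "\<dots> = c_gf (Suc q) (\<lambda>cs. iter_sum 0 (drop (Suc k) cs))
      + (c_gf q (\<lambda>cs. iter_sum 1 (drop k (0 # cs)))
         + fps_X ^ Suc q * c_gf (Suc q) (\<lambda>cs. iter_sum 0 (drop k cs)))"
    unfolding c_gf_add c_gf_Suc[of q "\<lambda>cs. iter_sum 1 (drop k cs)"]
    using iter_sum_shift[of 0] by (simp add: drop_map)
  finally show ?thesis by (simp add: algebra_simps)
qed

lemma grid_series_diag:
  "(1 - fps_X ^ Suc q) * grid_series (Suc q) (Suc q) = grid_series q (Suc q)"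
proof -
  \<comment> \<open>The outermost range runs from 1 to 0: c_1 = 0 leaves no room for d_1.\<close>
  have "c_gf q (\<lambda>cs. iter_sum 1 (drop 0 (0 # cs))) = 0"
    by (rule fps_ext) (simp add: c_gf_def)
  thus ?thesis
    using grid_series_step[of 0 q] by (simp add: grid_series_def drop_Suc del: power_Suc)
qed

text \<open>Once c_1 = 0 is removed, the pairs whose remaining d are all at least 1 are those of
  G(p+1, q) except the ones whose first remaining d is 0, and the latter are counted by G(p,
  q).\<close>

lemma grid_series_Suc_Suc:
  assumes "p < q"
  shows "(1 - fps_X ^ Suc q) * grid_series (Suc p) (Suc q)
    = grid_series p (Suc q) + grid_series (Suc p) q - grid_series p q"
proof -
  define k where "k = q - Suc p"
  have k: "q - p = Suc k" "Suc q - p = Suc (Suc k)" "q - Suc p = k" "k < q"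
    using assms by (auto simp: k_def)
  have "grid_series (Suc p) q
    = c_gf q (\<lambda>cs. iter_sum 0 (drop (Suc k) cs) + iter_sum 1 (drop k cs))"
    unfolding grid_series_def k using k iter_sum_drop[where d=0] by (intro c_gf_cong) force
  hence "c_gf q (\<lambda>cs. iter_sum 1 (drop k cs)) = grid_series (Suc p) q - grid_series p q"
    by (simp add: c_gf_add grid_series_def k)
  thus ?thesis
    using grid_series_step[of "Suc k" q] k by (simp add: grid_series_def del: power_Suc)
qed

section \<open>F_r(x) as a diagonal entry of the grid\<close>

text \<open>Splitting off the first entry \<open>e\<close> leaves a tail with lower bound
  \<open>e\<close>, as in the iterated sum. Finiteness is part of the induction because the
  cardinality of the disjoint union needs finite fibres.\<close>

lemma card_bounded_sorted:
  "finite {ds. length ds = length cs \<and> sorted ds \<and> (\<forall>x\<in>set ds. d \<le> x) \<and>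
     (\<forall>i<length cs. ds ! i \<le> cs ! i)} \<and>
   card {ds. length ds = length cs \<and> sorted ds \<and> (\<forall>x\<in>set ds. d \<le> x) \<and>
     (\<forall>i<length cs. ds ! i \<le> cs ! i)} = iter_sum d cs"
proof (induction cs arbitrary: d)
  case Nil
  have "{ds. length ds = length [] \<and> sorted ds \<and> (\<forall>x\<in>set ds. d \<le> x) \<and>
     (\<forall>i<length []. ds ! i \<le> [] ! i)} = {[]}" by auto
  thus ?case by simp
next
  case (Cons c cs)
  define S where "S e cs = {ds. length ds = length cs \<and> sorted ds \<and> (\<forall>x\<in>set ds. e \<le> x) \<and>
     (\<forall>i<length cs. ds ! i \<le> cs ! i)}" for e :: int and cs
  have IH: "finite (S e cs)" "card (S e cs) = iter_sum e cs" for e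
    using Cons unfolding S_def by auto
  have Cons_iff: "e # es \<in> S d (c # cs) \<longleftrightarrow> d \<le> e \<and> e \<le> c \<and> es \<in> S e cs" for e es
    by (auto simp: S_def All_less_Suc2)
  have "ds \<in> S d (c # cs) \<longleftrightarrow> ds \<in> (\<lambda>(e, ds). e # ds) ` (SIGMA e:{d..c}. S e cs)" for ds
  proof (cases ds)
    case Nil
    thus ?thesis by (auto simp: S_def)
  next
    case (Cons e es)
    thus ?thesis by (auto simp: Cons_iff image_iff)
  qed
  hence "S d (c # cs) = (\<lambda>(e, ds). e # ds) ` (SIGMA e:{d..c}. S e cs)" by blast
  moreover have "inj_on (\<lambda>(e, ds). e # ds) (SIGMA e:{d..c}. S e cs)"
    by (auto simp: inj_on_def)
  ultimately have "finite (S d (c # cs))" "card (S d (c # cs)) = iter_sum d (c # cs)"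
    by (simp_all add: card_image card_SigmaI IH)
  thus ?case unfolding S_def by blast
qed

lemma F1_series_eq: "F1_series r = grid_series r r"
proof (rule fps_ext)
  fix k
  let ?S = "\<lambda>cs. {ds. length ds = length cs \<and> sorted ds \<and> (\<forall>x\<in>set ds. 0 \<le> x) \<and>
     (\<forall>i<length cs. ds ! i \<le> cs ! i)}"
  have "{(cs, ds). cs \<in> c_seqs r k \<and> length ds = r \<and> sorted ds \<and>
     (\<forall>d\<in>set ds. 0 \<le> d) \<and> (\<forall>i<r. ds ! i \<le> cs ! i)} = (SIGMA cs:c_seqs r k. ?S cs)"
    by (auto simp: c_seqs_def)
  hence "alpha1 r k = (\<Sum>cs\<in>c_seqs r k. iter_sum 0 cs)"
    unfolding alpha1_def using card_bounded_sorted[where d=0]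
    by (simp add: card_SigmaI finite_c_seqs)
  thus "F1_series r $ k = grid_series r r $ k"
    by (simp add: F1_series_def grid_series_def c_gf_def)
qed

section \<open>The additional row in the variable y\<close>

text \<open>The rows \<open>q \<le> r\<close> of the grid for \<open>F\<^sub>r(x, y)\<close> do not involve \<open>y\<close>; this is the row
  \<open>q = r + 1\<close>, of weight \<open>y\<close>, without its last entry \<open>F\<^sub>r(x, y)\<close>.\<close>

definition y_row :: "nat \<Rightarrow> nat \<Rightarrow> int fps fps" where
  "y_row r p = Abs_fps (\<lambda>j. c_gf r (\<lambda>cs. iter_sum (- int j) (drop (r - p) cs)))"

text \<open>No d remains, so the coefficients are independent of j and form a geometric series in
  y.\<close>

lemma y_row_0: "(1 - fps_X) * y_row r 0 = fps_const (grid_series 0 r)"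
proof (rule fps_ext)
  fix j
  have "c_gf r (\<lambda>cs. iter_sum (- int j) (drop (r - 0) cs)) = c_gf r (\<lambda>_. 1)" for j
    by (rule c_gf_cong) simp
  thus "((1 - fps_X) * y_row r 0) $ j = fps_const (grid_series 0 r) $ j"
    by (cases j) (simp_all add: y_row_def grid_series_0 left_diff_distrib)
qed

text \<open>The first remaining d either equals -j and is removed, or is at least -(j-1), which
  gives the preceding coefficient. For j = 0 there is no preceding coefficient, and the two constant
  series make the correction.\<close>

lemma y_row_Suc:
  assumes "p < r"
  shows "(1 - fps_X) * y_row r (Suc p)
    = y_row r p + fps_const (grid_series (Suc p) r) - fps_const (grid_series p r)"
proof (rule fps_ext)
  fix j
  define k where "k = r - Suc p"
  have k: "r - p = Suc k" "r - Suc p = k" "k < r" using assms by (auto simp: k_def)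
  show "((1 - fps_X) * y_row r (Suc p)) $ j
    = (y_row r p + fps_const (grid_series (Suc p) r) - fps_const (grid_series p r)) $ j"
  proof (cases j)
    case (Suc i)
    have "c_gf r (\<lambda>cs. iter_sum (- int j) (drop k cs))
      = c_gf r (\<lambda>cs. iter_sum (- int j) (drop (Suc k) cs) + iter_sum (- int i) (drop k cs))"
      using k iter_sum_drop[where d="- int j"] Suc by (intro c_gf_cong) force
    thus ?thesis using Suc by (simp add: y_row_def k left_diff_distrib c_gf_add)
  qed (simp add: y_row_def k left_diff_distrib grid_series_def)
qed

text \<open>The same split applies to d_0: for d_0 = -j the lower bound of d_1 is -j, and the larger
  values of d_0 give the coefficient of y^(j-1).\<close>

lemma F2_series_eq: "(1 - fps_X) * F2_series r = y_row r r"
proof -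
  have F: "F2_series r $ j = c_gf r (\<lambda>cs. \<Sum>d\<^sub>0 = - int j..0. iter_sum d\<^sub>0 cs)" for j
    by (simp add: F2_series_def c_gf_def alpha2_def)
  show ?thesis
  proof (rule fps_ext)
    fix j
    show "((1 - fps_X) * F2_series r) $ j = y_row r r $ j"
    proof (cases j)
      case 0
      thus ?thesis by (simp add: left_diff_distrib F y_row_def)
    next
      case (Suc i)
      have "{- int j..0} = insert (- int j) {- int i..0}" using Suc by auto
      hence "F2_series r $ j = c_gf r (\<lambda>cs. iter_sum (- int j) cs) + F2_series r $ i"
        using Suc by (simp add: F flip: c_gf_add)
      thus ?thesis using Suc by (simp add: left_diff_distrib y_row_def)
    qed
  qed
qed

section \<open>Closure properties of expansions of rational functions\<close>

lemma is_expansion1_1: "is_expansion1 1 1"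
  unfolding is_expansion1_def by (intro exI[of _ 1]) (simp add: One_fract_def)

lemma is_expansion1_lin:
  assumes "is_expansion1 f a" "is_expansion1 g b"
  shows "is_expansion1 (f + g) (a + b)" "is_expansion1 (f - g) (a - b)"
proof -
  obtain P Q P' Q' where *: "coeff Q 0 \<noteq> 0" "a = Fract P Q" "fps_of_poly Q * f = fps_of_poly P"
    "coeff Q' 0 \<noteq> 0" "b = Fract P' Q'" "fps_of_poly Q' * g = fps_of_poly P'"
    using assms unfolding is_expansion1_def by metis
  have Q: "Q \<noteq> 0" "Q' \<noteq> 0" "coeff (Q * Q') 0 \<noteq> 0" using * by (auto simp: coeff_mult)
  have "fps_of_poly (Q * Q') * (f + g) = fps_of_poly (P * Q' + P' * Q)"
    by (simp add: fps_of_poly_mult fps_of_poly_add algebra_simps flip: *(3,6))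
  thus "is_expansion1 (f + g) (a + b)" unfolding is_expansion1_def using * Q
    by (intro exI[of _ "P * Q' + P' * Q"] exI[of _ "Q * Q'"]) simp
  have "fps_of_poly (Q * Q') * (f - g) = fps_of_poly (P * Q' - P' * Q)"
    by (simp add: fps_of_poly_mult fps_of_poly_diff algebra_simps flip: *(3,6))
  thus "is_expansion1 (f - g) (a - b)" unfolding is_expansion1_def using * Q
    by (intro exI[of _ "P * Q' - P' * Q"] exI[of _ "Q * Q'"]) simp
qed

text \<open>This provides the division step of \<open>grid_gf_rel\<close>. The denominator is
  multiplied by \<open>w\<close>, whose nonzero constant term keeps it admissible.\<close>

lemma is_expansion1_divide:
  assumes "is_expansion1 (fps_of_poly w * f) a" "coeff w 0 \<noteq> 0"
  shows "is_expansion1 f (a / to_fract w)"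
proof -
  obtain P Q where *: "coeff Q 0 \<noteq> 0" "a = Fract P Q"
    "fps_of_poly Q * (fps_of_poly w * f) = fps_of_poly P"
    using assms unfolding is_expansion1_def by metis
  show ?thesis unfolding is_expansion1_def using * assms
    by (intro exI[of _ P] exI[of _ "Q * w"])
       (simp add: coeff_mult fps_of_poly_mult mult.assoc to_fract_def)
qed

lemma fps_of_poly2_1: "fps_of_poly2 1 = 1"
  by (simp add: fps_of_poly2_def)

lemma fps_of_poly2_lin:
  "fps_of_poly2 (p + q) = fps_of_poly2 p + fps_of_poly2 q"
  "fps_of_poly2 (p - q) = fps_of_poly2 p - fps_of_poly2 q"
  by (rule fps_ext; simp add: fps_of_poly2_def coeff_map_poly fps_of_poly_add fps_of_poly_diff)+

lemma is_expansion2_1: "is_expansion2 1 1"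
  unfolding is_expansion2_def by (intro exI[of _ 1]) (simp add: One_fract_def)

lemma is_expansion2_lin:
  assumes "is_expansion2 f a" "is_expansion2 g b"
  shows "is_expansion2 (f + g) (a + b)" "is_expansion2 (f - g) (a - b)"
proof -
  obtain P Q P' Q' where *: "coeff (coeff Q 0) 0 \<noteq> 0" "a = Fract P Q"
    "fps_of_poly2 Q * f = fps_of_poly2 P"
    "coeff (coeff Q' 0) 0 \<noteq> 0" "b = Fract P' Q'" "fps_of_poly2 Q' * g = fps_of_poly2 P'"
    using assms unfolding is_expansion2_def by metis
  have Q: "Q \<noteq> 0" "Q' \<noteq> 0" "coeff (coeff (Q * Q') 0) 0 \<noteq> 0" using * by (auto simp: coeff_mult)
  have "fps_of_poly2 (Q * Q') * (f + g) = fps_of_poly2 (P * Q' + P' * Q)"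
    by (simp add: fps_of_poly2_mult fps_of_poly2_lin algebra_simps flip: *(3,6))
  thus "is_expansion2 (f + g) (a + b)" unfolding is_expansion2_def using * Q
    by (intro exI[of _ "P * Q' + P' * Q"] exI[of _ "Q * Q'"]) simp
  have "fps_of_poly2 (Q * Q') * (f - g) = fps_of_poly2 (P * Q' - P' * Q)"
    by (simp add: fps_of_poly2_mult fps_of_poly2_lin algebra_simps flip: *(3,6))
  thus "is_expansion2 (f - g) (a - b)" unfolding is_expansion2_def using * Q
    by (intro exI[of _ "P * Q' - P' * Q"] exI[of _ "Q * Q'"]) simp
qed

lemma is_expansion2_divide:
  assumes "is_expansion2 (fps_of_poly2 w * f) a" "coeff (coeff w 0) 0 \<noteq> 0"
  shows "is_expansion2 f (a / to_fract w)"
proof -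
  obtain P Q where *: "coeff (coeff Q 0) 0 \<noteq> 0" "a = Fract P Q"
    "fps_of_poly2 Q * (fps_of_poly2 w * f) = fps_of_poly2 P"
    using assms unfolding is_expansion2_def by metis
  show ?thesis unfolding is_expansion2_def using * assms
    by (intro exI[of _ P] exI[of _ "Q * w"])
       (simp add: coeff_mult fps_of_poly2_mult mult.assoc to_fract_def)
qed

section \<open>Substitution of inverse variables as a field homomorphism\<close>

lemma eval1_1: "eval1 1 u = 1"
  by (simp add: eval1_def)

lemma eval2_1: "eval2 1 u v = 1"
  by (simp add: eval2_def eval1_1)

lemma eval2_add: "eval2 (p + q) u v = eval2 p u v + eval2 q u v"
proof -
  have "map_poly (\<lambda>a. eval1 a u) (p + q) = map_poly (\<lambda>a. eval1 a u) p + map_poly (\<lambda>a. eval1 a u) q"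
    by (rule poly_eqI) (simp add: coeff_map_poly eval1_add)
  thus ?thesis by (simp add: eval2_def)
qed

text \<open>No nonzero denominator vanishes at 1/x, so the value can be computed from any
  representing fraction, in particular from unreduced sums and products.\<close>

lemma subst1_inverse:
  fixes a b :: ratfun1
  defines "\<phi> \<equiv> \<lambda>R. subst1 R (1 / var_x1)"
  shows "\<phi> (a + b) = \<phi> a + \<phi> b" "\<phi> (a * b) = \<phi> a * \<phi> b" "\<phi> (to_fract p) = eval1 p (1 / var_x1)"
proof -
  note [simp] = subst1_Fract eval1_inverse_nonzero eval1_mult eval1_add eval1_1
  obtain P Q P' Q' where *: "a = Fract P Q" "Q \<noteq> 0" "b = Fract P' Q'" "Q' \<noteq> 0"
    by (metis Fract_cases)
  show "\<phi> (a + b) = \<phi> a + \<phi> b" using * by (simp add: \<phi>_def add_frac_eq)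
  show "\<phi> (a * b) = \<phi> a * \<phi> b" using * by (simp add: \<phi>_def)
  show "\<phi> (to_fract p) = eval1 p (1 / var_x1)" by (simp add: \<phi>_def to_fract_def)
qed

lemma subst2_inverse:
  fixes a b :: ratfun2
  defines "\<phi> \<equiv> \<lambda>R. subst2 R (1 / var_x2) (1 / var_y2)"
  shows "\<phi> (a + b) = \<phi> a + \<phi> b" "\<phi> (a * b) = \<phi> a * \<phi> b"
    "\<phi> (to_fract p) = eval2 p (1 / var_x2) (1 / var_y2)"
proof -
  note [simp] = subst2_Fract eval2_inverse_nonzero eval2_mult eval2_add eval2_1
  obtain P Q P' Q' where *: "a = Fract P Q" "Q \<noteq> 0" "b = Fract P' Q'" "Q' \<noteq> 0"
    by (metis Fract_cases)
  show "\<phi> (a + b) = \<phi> a + \<phi> b" using * by (simp add: \<phi>_def add_frac_eq)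
  show "\<phi> (a * b) = \<phi> a * \<phi> b" using * by (simp add: \<phi>_def)
  show "\<phi> (to_fract p) = eval2 p (1 / var_x2) (1 / var_y2)" by (simp add: \<phi>_def to_fract_def)
qed

lemma eval1_monom: "eval1 (monom 1 q) z = z ^ q"
  by (simp add: eval1_def map_poly_monom poly_monom)

lemma prod_powers: "(\<Prod>i=1..n. z ^ i) = (z :: 'a::comm_monoid_mult) ^ (n * (n + 1) div 2)"
  using gauss_sum_from_Suc_0[where 'a=nat, of n] by (simp add: power_sum[symmetric] algebra_simps)

section \<open>The two functional equations\<close>

lemma F1_functional_equation:
  "is_expansion1 (F1_series r) (F1 r) \<and>
   F1 r = var_x1 powi (- int (r * (r + 3) div 2)) * subst1 (F1 r) (1 / var_x1)"
proof -
  let ?u = "\<lambda>q. var_x1 ^ q"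
  have u: "?u q = to_fract (monom 1 q)" for q by (simp add: to_fract_monom1)
  have u1: "?u q \<noteq> 1" if "1 \<le> q" for q
  proof
    assume "?u q = 1"
    hence "to_fract (monom 1 q :: int poly) = to_fract 1" by (simp add: u)
    hence "monom 1 q = (1 :: int poly)" by (simp only: to_fract_eq_iff)
    thus False using that by (simp add: monom_eq_1_iff)
  qed
  have "is_expansion1 (grid_series r r) (grid_gf ?u r r)"
  proof (rule grid_gf_rel[where n=r and e=grid_series and v="\<lambda>q. fps_X ^ q"])
    fix q and a :: "int fps" and b
    assume "1 \<le> q" "is_expansion1 ((1 - fps_X ^ q) * a) b"
    thus "is_expansion1 a (b / (1 - ?u q))"
      using is_expansion1_divide[of "1 - monom 1 q" a b]
      by (simp add: u fps_of_poly_diff fps_of_poly_monom')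
  qed (auto simp only: is_expansion1_1 is_expansion1_lin grid_series_0_0 grid_series_0_Suc
        grid_series_diag grid_series_Suc_Suc order_refl)
  hence exp: "is_expansion1 (F1_series r) (grid_gf ?u r r)" by (simp add: F1_series_eq)
  hence F: "F1 r = grid_gf ?u r r"
    unfolding F1_def using is_expansion1_unique by blast
  have "subst1 (grid_gf ?u r r) (1 / var_x1) = grid_gf (\<lambda>i. subst1 (?u i) (1 / var_x1)) r r"
    using subst1_inverse(3)[of 1]
    by (intro grid_gf_hom[of "\<lambda>R. subst1 R (1 / var_x1)"]) (simp_all add: subst1_inverse eval1_1)
  also have "\<dots> = grid_gf (\<lambda>i. 1 / ?u i) r r"
    by (simp add: u subst1_inverse eval1_monom power_one_over)
  \<comment> \<open>For r = 0 the premise on the weight of index 0 holds since x^0 = 1.\<close>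
  also have "\<dots> = (\<Prod>i=1..r. ?u i) * ?u r * grid_gf ?u r r"
    using u1 by (intro grid_gf_inverse_diag) auto
  also have "(\<Prod>i=1..r. ?u i) * ?u r = var_x1 ^ (r * (r + 3) div 2)"
  proof -
    have "r * (r + 3) = r * (r + 1) + 2 * r" by (simp add: algebra_simps)
    hence "r * (r + 3) div 2 = r * (r + 1) div 2 + r" by simp
    thus ?thesis by (simp only: prod_powers power_add)
  qed
  finally show ?thesis using exp by (simp add: F power_int_minus)
qed

lemma F2_functional_equation:
  "is_expansion2 (F2_series r) (F2 r) \<and>
   F2 r = var_x2 powi (- int (r * (r + 1) div 2)) * var_y2 powi (-2)
            * subst2 (F2 r) (1 / var_x2) (1 / var_y2)"
proof -
  define n where "n = Suc r"
  \<comment> \<open>\<open>w\<close>, \<open>v\<close> and \<open>u\<close> are the same weights as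
    polynomials, power series and rational functions: x^q, except y at index
    \<open>n\<close>.\<close>
  define w :: "nat \<Rightarrow> int poly poly" where
    "w q = (if q = n then [:0, 1:] else [:monom 1 q:])" for q
  define v :: "nat \<Rightarrow> int fps fps" where
    "v q = (if q = n then fps_X else fps_const (fps_X ^ q))" for q
  define u where "u q = (if q = n then var_y2 else var_x2 ^ q)" for q
  have u: "u q = to_fract (w q)" for q
    by (simp add: u_def w_def var_y2_def to_fract_monom2_const)
  have v: "v q = fps_of_poly2 (w q)" for q
    by (simp add: v_def w_def fps_of_poly2_def map_poly_pCons fps_of_poly_pCons fps_of_poly_monom')
  have w: "w q \<noteq> 1" "coeff (coeff (1 - w q) 0) 0 = 1" if "1 \<le> q" for q
    using that by (auto simp: w_def one_pCons coeff_monom dest: arg_cong[of _ _ "\<lambda>p. coeff p 0"])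
  have u1: "u q \<noteq> 1" if "1 \<le> q" for q
  proof
    assume "u q = 1"
    hence "to_fract (w q) = to_fract 1" by (simp add: u)
    hence "w q = 1" by (simp only: to_fract_eq_iff)
    thus False using w that by blast
  qed
  \<comment> \<open>Column index \<open>n\<close> is the row involving y, with the full series
    F_r(x, y) at its diagonal end; all other entries are constant in y.\<close>
  define e where "e p q = (if q = n then if p = n then F2_series r else y_row r p
    else fps_const (grid_series p q))" for p q
  have v_const: "(1 - v q) * fps_const f = fps_const ((1 - fps_X ^ q) * f)" if "q \<noteq> n" for q f
    using that by (simp add: v_def flip: fps_const_sub fps_const_mult)
  have e_const: "e p q = fps_const (grid_series p q)" if "q \<noteq> n" for p q
    using that by (simp add: e_def)
  have e0: "e 0 0 = 1" by (simp add: e_def n_def grid_series_0_0)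
  have "is_expansion2 (e n n) (grid_gf u n n)"
  proof (rule grid_gf_rel[where n=n and e=e and v=v])
    fix q and a :: "int fps fps" and b
    assume "1 \<le> q" "is_expansion2 ((1 - v q) * a) b"
    thus "is_expansion2 a (b / (1 - u q))"
      using is_expansion2_divide[of "1 - w q" a b] w[of q]
      by (simp add: u v fps_of_poly2_lin fps_of_poly2_1)
  next
    fix q assume "Suc q \<le> n"
    show "(1 - v (Suc q)) * e 0 (Suc q) = e 0 q"
    proof (cases "Suc q = n")
      case True
      thus ?thesis using y_row_0[of r] by (simp add: e_def v_def n_def)
    next
      case False
      thus ?thesis using \<open>Suc q \<le> n\<close>
        by (simp add: e_const v_const grid_series_0_Suc del: power_Suc)
    qed
  next
    fix p q assume "Suc q \<le> n" "p < q"
    show "(1 - v (Suc q)) * e (Suc p) (Suc q) = e p (Suc q) + e (Suc p) q - e p q"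
    proof (cases "Suc q = n")
      case True
      thus ?thesis using y_row_Suc[of p r] \<open>p < q\<close> by (simp add: e_def v_def n_def)
    next
      case False
      thus ?thesis using \<open>Suc q \<le> n\<close> \<open>p < q\<close>
        by (simp add: e_const v_const grid_series_Suc_Suc del: power_Suc)
    qed
  next
    fix q assume "Suc q \<le> n"
    show "(1 - v (Suc q)) * e (Suc q) (Suc q) = e q (Suc q)"
    proof (cases "Suc q = n")
      case True
      thus ?thesis using F2_series_eq[of r] by (simp add: e_def v_def n_def)
    next
      case False
      thus ?thesis using \<open>Suc q \<le> n\<close>
        by (simp add: e_const v_const grid_series_diag del: power_Suc)
    qed
  qed (simp_all only: is_expansion2_1 is_expansion2_lin e0 order_refl)
  hence exp: "is_expansion2 (F2_series r) (grid_gf u n n)" by (simp add: e_def)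
  hence F: "F2 r = grid_gf u n n"
    unfolding F2_def using is_expansion2_unique by blast
  have "subst2 (grid_gf u n n) (1 / var_x2) (1 / var_y2)
      = grid_gf (\<lambda>i. subst2 (u i) (1 / var_x2) (1 / var_y2)) n n"
    using subst2_inverse(3)[of 1]
    by (intro grid_gf_hom[of "\<lambda>R. subst2 R (1 / var_x2) (1 / var_y2)"])
       (simp_all add: subst2_inverse eval2_1)
  also have "(\<lambda>i. subst2 (u i) (1 / var_x2) (1 / var_y2)) = (\<lambda>i. 1 / u i)"
    by (rule ext) (simp add: u subst2_inverse, simp add: w_def eval2_def map_poly_pCons
        eval1_monom eval1_1 power_one_over to_fract_monom2_const flip: var_y2_def)
  also have "grid_gf (\<lambda>i. 1 / u i) n n = (\<Prod>i=1..n. u i) * u n * grid_gf u n n"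
    using u1 by (intro grid_gf_inverse_diag) (auto simp: u_def n_def)
  also have "(\<Prod>i=1..n. u i) = (\<Prod>i=1..r. var_x2 ^ i) * var_y2"
    by (simp add: n_def u_def)
  also have "(\<Prod>i=1..r. var_x2 ^ i) = var_x2 ^ (r * (r + 1) div 2)" by (rule prod_powers)
  \<comment> \<open>The variable y now occurs twice, as the last factor of the product and as the
    extra factor \<open>u n\<close>, which yields y^2.\<close>
  also have "u n = var_y2" by (simp add: u_def)
  finally show ?thesis using exp
    by (simp add: F power_int_minus divide_simps power2_eq_square)
qed

theorem proposition4:
  fixes r :: nat
  shows "is_expansion2 (F2_series r) (F2 r) \<and>
         F2 r = var_x2 powi (- int (r * (r + 1) div 2)) * var_y2 powi (-2)
                  * subst2 (F2 r) (1 / var_x2) (1 / var_y2) \<and>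
         is_expansion1 (F1_series r) (F1 r) \<and>
         F1 r = var_x1 powi (- int (r * (r + 3) div 2)) * subst1 (F1 r) (1 / var_x1)"
  using F1_functional_equation F2_functional_equation by blast

end
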